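(* Let $L:[1,\infty)\to[1,\infty)$ be any function. For every integer $r\ge2$, setting $K:=r^2$ gives $$\Gamma_L(K)\le\frac1r=K^{-1/2}.$$ Consequently, let $\gamma:[1,\infty)\to[0,1]$ be a function such that, for every $K\ge1$ and every $n\geq 1$, every nonempty $B\subseteq\mathbb F_2^n$ with $E(B)\ge\frac1K|B|^3$ contains a nonempty $Y\subseteq B$ satisfying $$|Y+Y|\le L(K)|Y|,\qquad|Y|\ge\gamma(K)|B|.$$ Then, for $K=r^2$ with $r\ge2$ an integer, $$\gamma(K)\le K^{-1/2}.$$ Moreover, for such $K=r^2$ and $\eta\ge0$, a positive universal lower bound for $|A\cap Y|/|A|$ inferred only from $Y\subseteq B$, $|Y|\ge\gamma(K)|B|$ and $|A\triangle B|\le\eta|A|$ (that is, a constant $c>0$ such that $|A\cap Y|\ge c|A|$ for all $n$ and all $A,B,Y\subseteq\mathbb F_2^n$, $A\ne\varnothing$, satisfying these three conditions) can hold only when $$\eta<\frac{\gamma(K)}{1-\gamma(K)}\le\frac1{r-1}=\frac1{\sqrt K-1}.$$ In particular, the contamination scale $\eta$ for which such a positive bound holds is at most $(1+o_{K\to\infty}(1))K^{-1/2}$ along the sequence $K=r^2$.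
   Context: For $S,T\subseteq\mathbb F_2^n$, $S+T=\{s+t:s\in S,t\in T\}$; $\triangle$ is symmetric difference. $E(S)=|\{(x_1,x_2,x_3,x_4)\in S^4:x_1+x_2=x_3+x_4\}|$ is the additive energy. For $K\ge1$ define $$\Gamma_L(K):=\inf_{\substack{n\ge1,\ \varnothing\ne S\subseteq\mathbb F_2^n\\ E(S)\ge K^{-1}|S|^3}}\ \max_{\substack{\varnothing\ne Y\subseteq S\\ |Y+Y|\le L(K)|Y|}}\frac{|Y|}{|S|}.$$ *)

theory Defs
  imports
    Complex_Main
    "HOL-Library.Z2"
    "HOL-Library.Set_Algebras"
    "Jordan_Normal_Form.Matrix"
begin

text \<open>
  The type \<^typ>\<open>bit\<close> is the two-element field, and the sum \<open>S + T\<close> of two sets is the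
  elementwise sum from \<^theory>\<open>HOL-Library.Set_Algebras\<close>.
\<close>

abbreviation F2 :: "nat \<Rightarrow> bit vec set" where
  "F2 n \<equiv> carrier_vec n"

definition additive_energy :: "bit vec set \<Rightarrow> nat" where
  "additive_energy S =
     card {(x1, x2, x3, x4). x1 \<in> S \<and> x2 \<in> S \<and> x3 \<in> S \<and> x4 \<in> S \<and> x1 + x2 = x3 + x4}"

text \<open>
  The conditionally complete \<open>Inf\<close> and \<open>Max\<close> on the reals take arbitrary values on empty sets.
  For \<open>K \<ge> 1\<close> and \<open>L K \<ge> 1\<close> both sets below are nonempty (take for \<open>S\<close> a subspace and for \<open>Y\<close>
  a singleton), the set under the maximum is finite, and the set under the infimum is bounded
  below by \<open>0\<close>.
\<close>

definition extraction_ratio :: "(real \<Rightarrow> real) \<Rightarrow> real \<Rightarrow> real" where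
  "extraction_ratio L K =
     Inf {Max {real (card Y) / real (card S) | Y.
             Y \<noteq> {} \<and> Y \<subseteq> S \<and> real (card (Y + Y)) \<le> L K * real (card Y)} | n S.
          n \<ge> 1 \<and> S \<noteq> {} \<and> S \<subseteq> F2 n \<and>
          real (additive_energy S) \<ge> inverse K * real (card S) ^ 3}"

text \<open>
  Functions on \<open>[1, \<infinity>)\<close> are total functions on the reals of which only the values on
  \<open>[1, \<infinity>)\<close> are used.
\<close>

definition extraction_guarantee :: "(real \<Rightarrow> real) \<Rightarrow> (real \<Rightarrow> real) \<Rightarrow> bool" where
  "extraction_guarantee L \<gamma> \<longleftrightarrow>
     (\<forall>K\<ge>1. \<forall>n\<ge>1. \<forall>B. B \<noteq> {} \<and> B \<subseteq> F2 n \<and>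
        real (additive_energy B) \<ge> 1 / K * real (card B) ^ 3 \<longrightarrow>
        (\<exists>Y. Y \<noteq> {} \<and> Y \<subseteq> B \<and>
           real (card (Y + Y)) \<le> L K * real (card Y) \<and>
           real (card Y) \<ge> \<gamma> K * real (card B)))"

text \<open>In the following definition \<open>g\<close> is the single number \<open>\<gamma>(K)\<close>.\<close>

definition positive_overlap_bound :: "real \<Rightarrow> real \<Rightarrow> bool" where
  "positive_overlap_bound g \<eta> \<longleftrightarrow>
     (\<exists>c>0. \<forall>n\<ge>1. \<forall>A B Y.
        A \<subseteq> F2 n \<and> B \<subseteq> F2 n \<and> Y \<subseteq> F2 n \<and> A \<noteq> {} \<and>
        Y \<subseteq> B \<and> real (card Y) \<ge> g * real (card B) \<and>
        real (card (sym_diff A B)) \<le> \<eta> * real (card A) \<longrightarrow>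
        real (card (A \<inter> Y)) \<ge> c * real (card A))"

end

theory Submission
  imports Defs
begin

text \<open>
  Let \<open>A\<^sub>1, \<dots>, A\<^sub>r\<close> be cosets of independent subspaces of order \<open>N\<close>, with independent
  representatives. Their union \<open>S\<close> has \<open>r N\<close> elements and energy at least
  \<open>r N\<^sup>3 = |S|\<^sup>3 / r\<^sup>2\<close>. If \<open>Y \<subseteq> S\<close> has doubling at most \<open>C\<close> and \<open>A\<^sub>i\<close> is the coset meeting \<open>Y\<close> most,
  then for \<open>j \<noteq> i\<close> the sums \<open>x + y\<close> with \<open>x \<in> Y \<inter> A\<^sub>i\<close>, \<open>y \<in> Y \<inter> A\<^sub>j\<close> are distinct, so
  \<open>|Y \<inter> A\<^sub>i| |Y \<inter> A\<^sub>j| \<le> C |Y| \<le> C r |Y \<inter> A\<^sub>i|\<close>. Hence \<open>Y\<close> has at most \<open>N + C r\<^sup>2\<close> elements, and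
  \<open>|Y| / |S|\<close> is at most \<open>1 / r + o(1)\<close> as \<open>N\<close> grows.

  For the contamination threshold, put \<open>B = A \<union> V\<close> with \<open>V\<close> disjoint from \<open>A\<close> and
  \<open>|V| = \<lfloor>g / (1 - g) |A|\<rfloor>\<close>, and let \<open>Y\<close> be \<open>V\<close> with one point of \<open>A\<close> added. The extra point
  absorbs the rounding, so that the endpoint \<open>\<eta> = g / (1 - g)\<close> is excluded even if it is irrational.
\<close>

section \<open>Independent cosets, described through the supports of their vectors\<close>

definition indicator_vec :: "nat \<Rightarrow> nat set \<Rightarrow> bit vec" where
  "indicator_vec n X = vec n (\<lambda>k. of_bool (k \<in> X))"

lemma indicator_vec_carrier [simp]: "indicator_vec n X \<in> F2 n"
  by (simp add: indicator_vec_def)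

lemma indicator_vec_add:
  "indicator_vec n X + indicator_vec n Y = indicator_vec n (sym_diff X Y)"
  by (rule eq_vecI) (auto simp: indicator_vec_def)

text \<open>Counting and injectivity for vectors thereby reduce to set algebra, with symmetric
  difference as addition.\<close>

lemma bij_betw_indicator_vec: "bij_betw (indicator_vec n) (Pow {..<n}) (F2 n)"
proof (rule bij_betwI[where g = "\<lambda>v. {k. k < n \<and> v $ k = 1}"])
  fix v :: "bit vec" assume "v \<in> F2 n"
  then show "indicator_vec n {k. k < n \<and> v $ k = 1} = v"
    by (intro eq_vecI) (auto simp: indicator_vec_def)
qed (auto simp: indicator_vec_def)

lemma inj_on_indicator_vec: "inj_on (indicator_vec n) (Pow {..<n})"
  using bij_betw_indicator_vec by (rule bij_betw_imp_inj_on)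

lemma finite_F2: "finite (F2 n)"
  using bij_betw_finite[OF bij_betw_indicator_vec] by simp

lemma card_F2: "card (F2 n) = 2 ^ n"
  using bij_betw_same_card[OF bij_betw_indicator_vec] by (simp add: card_Pow)

text \<open>Each index owns a block of \<open>m + 1\<close> coordinates. The first is always present
  and acts as the coset representative; the other \<open>m\<close> are free and span a subspace of
  order \<open>2 ^ m\<close>. Disjoint blocks make both the subspaces and the representatives
  independent.\<close>

definition coset_supports :: "nat \<Rightarrow> nat \<Rightarrow> nat set set" where
  "coset_supports m i = {X. i * Suc m \<in> X \<and> X \<subseteq> {i * Suc m..<Suc i * Suc m}}"

lemma card_coset_supports: "card (coset_supports m i) = 2 ^ m"
proof -
  have "bij_betw (insert (i * Suc m)) (Pow {Suc (i * Suc m)..<Suc i * Suc m}) (coset_supports m i)"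
  proof (rule bij_betwI[where g = "\<lambda>X. X - {i * Suc m}"])
    show "(\<lambda>X. X - {i * Suc m}) \<in> coset_supports m i \<rightarrow> Pow {Suc (i * Suc m)..<Suc i * Suc m}"
      unfolding coset_supports_def by (fastforce simp del: mult_Suc mult_Suc_right)
  qed (auto simp: coset_supports_def)
  from bij_betw_same_card[OF this] show ?thesis
    by (simp add: card_Pow)
qed

lemma coset_supports_subset:
  assumes "i < r"
  shows "coset_supports m i \<subseteq> Pow {..<r * Suc m}"
proof -
  have "Suc i * Suc m \<le> r * Suc m"
    using assms by (intro mult_le_mono1) simp
  then have "{i * Suc m..<Suc i * Suc m} \<subseteq> {..<r * Suc m}"
    by (meson atLeastLessThan_iff lessThan_iff order_less_le_trans subsetI)
  then show ?thesis
    unfolding coset_supports_def by blast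
qed

lemma coset_supports_disjnt:
  assumes "i \<noteq> j" "X \<in> coset_supports m i" "Y \<in> coset_supports m j"
  shows "X \<inter> Y = {}"
proof -
  have "Suc i * Suc m \<le> j * Suc m \<or> Suc j * Suc m \<le> i * Suc m"
    using \<open>i \<noteq> j\<close> by (metis Suc_leI linorder_neqE_nat mult_le_mono1)
  then have "{i * Suc m..<Suc i * Suc m} \<inter> {j * Suc m..<Suc j * Suc m} = {}"
    by (meson atLeastLessThan_iff disjoint_iff leD order_less_le_trans order_trans)
  then show ?thesis
    using assms(2,3) unfolding coset_supports_def by blast
qed

text \<open>Supports from different blocks do not meet, so the symmetric difference is a disjoint
  union from which each part can be read off.\<close>

lemma inj_on_sym_diff_coset_supports:
  assumes "i \<noteq> j"
  shows "inj_on (\<lambda>(X, Y). sym_diff X Y) (coset_supports m i \<times> coset_supports m j)"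
proof (rule inj_onI, clarify)
  fix X Y X' Y'
  assume *: "X \<in> coset_supports m i" "Y \<in> coset_supports m j"
    "X' \<in> coset_supports m i" "Y' \<in> coset_supports m j" "sym_diff X Y = sym_diff X' Y'"
  have "X \<inter> Y = {}" "X \<inter> Y' = {}" "X' \<inter> Y = {}" "X' \<inter> Y' = {}"
    using * assms coset_supports_disjnt by metis+
  with *(5) show "X = X' \<and> Y = Y'" by blast
qed

definition coset_vecs :: "nat \<Rightarrow> nat \<Rightarrow> nat \<Rightarrow> bit vec set" where
  "coset_vecs r m i = indicator_vec (r * Suc m) ` coset_supports m i"

lemma coset_vecs_subset: "coset_vecs r m i \<subseteq> F2 (r * Suc m)"
  by (auto simp: coset_vecs_def)

lemma finite_coset_vecs: "finite (coset_vecs r m i)"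
  using finite_F2 coset_vecs_subset by (rule finite_subset[rotated])

lemma card_coset_vecs: "i < r \<Longrightarrow> card (coset_vecs r m i) = 2 ^ m"
  unfolding coset_vecs_def
  using card_image[OF inj_on_subset[OF inj_on_indicator_vec coset_supports_subset]]
  by (simp add: card_coset_supports)

text \<open>A sum of three elements of a coset stays in it: the fixed coordinate occurs three times
  and survives modulo 2.\<close>

lemma coset_vecs_add_add:
  assumes "x \<in> coset_vecs r m i" "y \<in> coset_vecs r m i" "z \<in> coset_vecs r m i"
  shows "x + y + z \<in> coset_vecs r m i"
  using assms
  by (fastforce simp: coset_vecs_def coset_supports_def indicator_vec_add)

lemma inj_on_add_coset_vecs:
  assumes "i < r" "j < r" "i \<noteq> j"
  shows "inj_on (\<lambda>(x, y). x + y) (coset_vecs r m i \<times> coset_vecs r m j)"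
proof (rule inj_onI, clarify)
  fix x y x' y'
  assume *: "x \<in> coset_vecs r m i" "y \<in> coset_vecs r m j"
    "x' \<in> coset_vecs r m i" "y' \<in> coset_vecs r m j" "x + y = x' + y'"
  obtain X Y X' Y' where sets: "X \<in> coset_supports m i" "Y \<in> coset_supports m j"
      "X' \<in> coset_supports m i" "Y' \<in> coset_supports m j"
    and eq: "x = indicator_vec (r * Suc m) X" "y = indicator_vec (r * Suc m) Y"
      "x' = indicator_vec (r * Suc m) X'" "y' = indicator_vec (r * Suc m) Y'"
    using * unfolding coset_vecs_def by blast
  have "X \<subseteq> {..<r * Suc m}" "Y \<subseteq> {..<r * Suc m}" "X' \<subseteq> {..<r * Suc m}" "Y' \<subseteq> {..<r * Suc m}"
    using sets coset_supports_subset assms by blast+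
  then have "sym_diff X Y = sym_diff X' Y'"
    using *(5) unfolding eq indicator_vec_add
    by (intro inj_onD[OF inj_on_indicator_vec]) blast+
  then have "(X, Y) = (X', Y')"
    using sets by (intro inj_onD[OF inj_on_sym_diff_coset_supports[OF \<open>i \<noteq> j\<close>]]) auto
  then show "x = x' \<and> y = y'"
    by (simp add: eq)
qed

lemma coset_vecs_disjnt:
  assumes "i < r" "j < r" "i \<noteq> j"
  shows "coset_vecs r m i \<inter> coset_vecs r m j = {}"
proof -
  have False if x: "x \<in> coset_vecs r m i" "x \<in> coset_vecs r m j" for x
  proof -
    obtain X Y where sets: "X \<in> coset_supports m i" "Y \<in> coset_supports m j"
      and "x = indicator_vec (r * Suc m) X" "x = indicator_vec (r * Suc m) Y"
      using x unfolding coset_vecs_def by blast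
    moreover have "X \<in> Pow {..<r * Suc m}" "Y \<in> Pow {..<r * Suc m}"
      using sets coset_supports_subset assms by blast+
    ultimately have "X = Y"
      by (metis inj_onD inj_on_indicator_vec)
    then show False
      \<comment> \<open>The common support contains the fixed coordinate \<open>i * Suc m\<close>,
        so it is nonempty and cannot be disjoint from itself.\<close>
      using coset_supports_disjnt[OF \<open>i \<noteq> j\<close> sets] sets by (auto simp: coset_supports_def)
  qed
  then show ?thesis by blast
qed

section \<open>The union of the cosets: cardinality and energy\<close>

definition coset_union :: "nat \<Rightarrow> nat \<Rightarrow> bit vec set" where
  "coset_union r m = (\<Union>i<r. coset_vecs r m i)"

lemma coset_union_subset: "coset_union r m \<subseteq> F2 (r * Suc m)"
  using coset_vecs_subset by (auto simp: coset_union_def)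

lemma card_subset_coset_union:
  assumes "Y \<subseteq> coset_union r m"
  shows "card Y = (\<Sum>i<r. card (Y \<inter> coset_vecs r m i))"
proof -
  have "card (\<Union>i<r. Y \<inter> coset_vecs r m i) = (\<Sum>i<r. card (Y \<inter> coset_vecs r m i))"
  proof (rule card_UN_disjoint)
    show "\<forall>i\<in>{..<r}. \<forall>j\<in>{..<r}. i \<noteq> j \<longrightarrow>
        Y \<inter> coset_vecs r m i \<inter> (Y \<inter> coset_vecs r m j) = {}"
      using coset_vecs_disjnt by blast
  qed (auto simp: finite_coset_vecs)
  moreover have "(\<Union>i<r. Y \<inter> coset_vecs r m i) = Y"
    using assms by (auto simp: coset_union_def)
  ultimately show ?thesis by simp
qed

lemma card_coset_union: "card (coset_union r m) = r * 2 ^ m"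
proof -
  have "coset_union r m \<inter> coset_vecs r m i = coset_vecs r m i" if "i < r" for i
    using that by (auto simp: coset_union_def)
  then show ?thesis
    by (simp add: card_subset_coset_union[OF subset_refl] card_coset_vecs)
qed

text \<open>Quadruples inside a single coset suffice: any triple \<open>(x, y, z)\<close> there is
  completed by \<open>x + y + z\<close>, which gives \<open>(2 ^ m) ^ 3\<close> quadruples for each
  of the \<open>r\<close> cosets.\<close>

lemma additive_energy_coset_union: "additive_energy (coset_union r m) \<ge> r * (2 ^ m) ^ 3"
proof -
  let ?S = "coset_union r m"
  define T where "T i = coset_vecs r m i \<times> coset_vecs r m i \<times> coset_vecs r m i" for i
  define Q where "Q = {(x1, x2, x3, x4). x1 \<in> ?S \<and> x2 \<in> ?S \<and> x3 \<in> ?S \<and> x4 \<in> ?S \<and> x1 + x2 = x3 + x4}"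
  have "finite ?S"
    using finite_F2 coset_union_subset by (rule finite_subset[rotated])
  then have "finite Q"
    by (intro finite_subset[of Q "?S \<times> ?S \<times> ?S \<times> ?S"]) (auto simp: Q_def)
  let ?f = "\<lambda>(x, y, z). (x, y, z, x + y + z)"
  \<comment> \<open>In characteristic 2 the two copies of \<open>z\<close> cancel; the common
    carrier makes the dimensions agree.\<close>
  have cancel: "x + y = z + (x + y + z)" if "x \<in> F2 n" "y \<in> F2 n" "z \<in> F2 n" for x y z n
    using that by (intro eq_vecI) (auto simp: algebra_simps)
  have "?f t \<in> Q" if "t \<in> T i" "i < r" for t i
  proof -
    obtain x y z where t: "t = (x, y, z)"
      by (cases t)
    then have xyz: "x \<in> coset_vecs r m i" "y \<in> coset_vecs r m i" "z \<in> coset_vecs r m i"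
      using that by (auto simp: T_def)
    moreover have "x + y = z + (x + y + z)"
      using xyz coset_vecs_subset by (intro cancel) blast+
    ultimately show ?thesis
      using coset_vecs_add_add[OF xyz] \<open>i < r\<close> unfolding t Q_def coset_union_def by auto
  qed
  then have "?f ` (\<Union>i<r. T i) \<subseteq> Q"
    by blast
  moreover have "inj_on ?f (\<Union>i<r. T i)"
    by (auto simp: inj_on_def)
  ultimately have "card (\<Union>i<r. T i) \<le> card Q"
    using \<open>finite Q\<close> by (intro card_inj_on_le)
  moreover have "card (\<Union>i<r. T i) = (\<Sum>i<r. card (T i))"
  proof (rule card_UN_disjoint)
    show "\<forall>i\<in>{..<r}. \<forall>j\<in>{..<r}. i \<noteq> j \<longrightarrow> T i \<inter> T j = {}"
      using coset_vecs_disjnt unfolding T_def by blast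
  qed (auto simp: T_def finite_coset_vecs)
  moreover have "(\<Sum>i<r. card (T i)) = r * (2 ^ m) ^ 3"
    by (simp add: T_def card_cartesian_product card_coset_vecs power3_eq_cube)
  ultimately show ?thesis
    by (simp add: additive_energy_def Q_def)
qed

section \<open>Subsets of small doubling and the resulting ratio bounds\<close>

lemma card_small_doubling_le:
  fixes C :: real
  assumes Y: "Y \<subseteq> coset_union r m" and dbl: "card (Y + Y) \<le> C * card Y" and C: "C \<ge> 0"
  shows "card Y \<le> 2 ^ m + C * (real r) ^ 2"
proof (cases "Y = {}")
  case True
  with C show ?thesis by simp
next
  case False
  define y where "y i = card (Y \<inter> coset_vecs r m i)" for i
  have cardY: "card Y = (\<Sum>i<r. y i)"
    unfolding y_def using Y by (rule card_subset_coset_union)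
  have "finite Y"
    using Y coset_union_subset finite_F2 by (meson finite_subset)
  with False have "card Y > 0" by (simp add: card_gt_0_iff)
  then have "r > 0"
    using cardY by (cases r) auto
  obtain i where i: "i < r" "\<And>j. j < r \<Longrightarrow> y j \<le> y i"
  proof -
    have "Max (y ` {..<r}) \<in> y ` {..<r}"
      using \<open>r > 0\<close> by (intro Max_in) auto
    then obtain i where "i < r" "Max (y ` {..<r}) = y i" by auto
    moreover have "y j \<le> Max (y ` {..<r})" if "j < r" for j
      using that by (intro Max_ge) auto
    ultimately show thesis using that by metis
  qed
  \<comment> \<open>Maximality of \<open>y i\<close> gives this bound, and with it the positivity
    that later allows cancelling \<open>y i\<close>.\<close>
  have Yi: "card Y \<le> r * y i"
    unfolding cardY using sum_bounded_above[of "{..<r}" y "y i"] i by simp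
  with \<open>card Y > 0\<close> have "y i > 0" by (cases "y i") auto
  have "finite (Y + Y)"
    using \<open>finite Y\<close> by (rule finite_set_plus) fact
  have other: "y j \<le> C * r" if "j < r" "j \<noteq> i" for j
  proof -
    let ?P = "(Y \<inter> coset_vecs r m i) \<times> (Y \<inter> coset_vecs r m j)"
    have "inj_on (\<lambda>(x, y). x + y) ?P"
      using that i by (intro inj_on_subset[OF inj_on_add_coset_vecs[of i r j m]]) auto
    moreover have "(\<lambda>(x, y). x + y) ` ?P \<subseteq> Y + Y"
      by auto
    ultimately have "card ?P \<le> card (Y + Y)"
      using \<open>finite (Y + Y)\<close> by (rule card_inj_on_le)
    then have "real (y i) * real (y j) \<le> card (Y + Y)"
      by (simp add: y_def card_cartesian_product flip: of_nat_mult)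
    also have "\<dots> \<le> C * card Y" by (rule dbl)
    also have "\<dots> \<le> C * (r * y i)"
      using Yi C by (intro mult_left_mono) (simp_all flip: of_nat_mult)
    finally have "real (y i) * real (y j) \<le> real (y i) * (C * r)"
      by (simp add: mult_ac)
    with \<open>y i > 0\<close> show ?thesis by simp
  qed
  \<comment> \<open>The largest piece gets only the trivial bound; the fewer than \<open>r\<close>
    remaining pieces contribute at most \<open>C * r\<close> each.\<close>
  have "real (y i) \<le> real (card (coset_vecs r m i))"
    unfolding y_def of_nat_le_iff by (intro card_mono finite_coset_vecs) auto
  then have yi: "real (y i) \<le> 2 ^ m"
    by (simp only: card_coset_vecs[OF \<open>i < r\<close>] of_nat_power of_nat_numeral)
  have "(\<Sum>j\<in>{..<r} - {i}. real (y j)) \<le> real (card ({..<r} - {i})) * (C * r)"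
    using other by (intro sum_bounded_above) auto
  also have "\<dots> \<le> r * (C * r)"
    using C card_Diff1_le[of "{..<r}" i] by (intro mult_right_mono) simp_all
  finally have "(\<Sum>j\<in>{..<r} - {i}. real (y j)) \<le> C * (real r) ^ 2"
    by (simp add: power2_eq_square mult_ac)
  moreover have "real (card Y) = real (y i) + (\<Sum>j\<in>{..<r} - {i}. real (y j))"
    using i(1) by (simp add: cardY sum.remove[of "{..<r}" i])
  ultimately show ?thesis
    using yi by linarith
qed

text \<open>A single \<open>S\<close> works for all \<open>Y\<close> of doubling at most
  \<open>C\<close>. Both ratio bounds below follow by letting \<open>e\<close> tend to 0.\<close>

lemma exists_energetic_set_with_small_extractions:
  fixes C e :: real and r :: nat
  assumes "C \<ge> 0" "e > 0" "r \<ge> 1"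
  obtains n S where "n \<ge> 1" "S \<noteq> {}" "S \<subseteq> F2 n"
    "additive_energy S \<ge> inverse (real r ^ 2) * real (card S) ^ 3"
    "\<And>Y. Y \<subseteq> S \<Longrightarrow> card (Y + Y) \<le> C * card Y \<Longrightarrow> card Y / card S \<le> 1 / r + e"
proof -
  \<comment> \<open>The error term \<open>C * r ^ 2\<close> must not exceed
    \<open>e * card S = e * r * 2 ^ m\<close>.\<close>
  obtain m :: nat where "C * r / e < 2 ^ m"
    using real_arch_pow[of 2 "C * r / e"] by auto
  then have m: "C * r \<le> e * 2 ^ m"
    using \<open>e > 0\<close> by (simp add: field_simps)
  show thesis
  proof
    show "r * Suc m \<ge> 1" using \<open>r \<ge> 1\<close> by simp
    show "coset_union r m \<noteq> {}"
      using card_coset_union[of r m] \<open>r \<ge> 1\<close> by auto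
    show "coset_union r m \<subseteq> F2 (r * Suc m)" by (rule coset_union_subset)
    have "inverse (real r ^ 2) * real (card (coset_union r m)) ^ 3 = real (r * (2 ^ m) ^ 3)"
      using \<open>r \<ge> 1\<close> by (simp add: card_coset_union field_simps power2_eq_square power3_eq_cube)
    also have "\<dots> \<le> additive_energy (coset_union r m)"
      using additive_energy_coset_union by (rule of_nat_mono)
    finally show "additive_energy (coset_union r m)
        \<ge> inverse (real r ^ 2) * real (card (coset_union r m)) ^ 3" .
    fix Y assume "Y \<subseteq> coset_union r m" "card (Y + Y) \<le> C * card Y"
    then have "card Y \<le> 2 ^ m + C * (real r) ^ 2"
      using \<open>C \<ge> 0\<close> by (rule card_small_doubling_le)
    also have "\<dots> \<le> 2 ^ m + e * 2 ^ m * r"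
      using mult_right_mono[OF m, of r] by (simp add: power2_eq_square mult_ac)
    also have "\<dots> = (1 / r + e) * card (coset_union r m)"
      using \<open>r \<ge> 1\<close> by (simp add: card_coset_union field_simps)
    finally show "card Y / card (coset_union r m) \<le> 1 / r + e"
      using \<open>r \<ge> 1\<close> by (simp add: card_coset_union divide_le_eq)
  qed
qed

lemma extraction_ratio_le:
  fixes r :: nat
  assumes L: "L ((real r)^2) \<ge> 1" and "r \<ge> 1"
  shows "extraction_ratio L ((real r)^2) \<le> 1 / r"
proof (rule field_le_epsilon)
  fix e :: real assume "e > 0"
  define K where "K = (real r)^2"
  define R where "R S = {real (card Y) / real (card S) | Y.
      Y \<noteq> {} \<and> Y \<subseteq> S \<and> real (card (Y + Y)) \<le> L K * real (card Y)}"
    for S :: "bit vec set"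
  have "L K \<ge> 1" using L by (simp add: K_def)
  then have "L K \<ge> 0" by simp
  have finite: "finite (R S)" if "S \<subseteq> F2 n" for S n
  proof -
    have "finite S" using that finite_F2 by (rule finite_subset)
    then have "finite ((\<lambda>Y. real (card Y) / real (card S)) ` Pow S)" by simp
    then show ?thesis by (rule rev_finite_subset) (auto simp: R_def)
  qed
  \<comment> \<open>A singleton has doubling 1, hence is admissible because
    \<open>L K \<ge> 1\<close>.\<close>
  have nonempty: "R S \<noteq> {}" if S: "S \<noteq> {}" for S
  proof -
    obtain s where "s \<in> S" using S by auto
    moreover have "{s} + {s} = {s + s}" by (auto simp: set_plus_def)
    ultimately have "real (card {s}) / real (card S) \<in> R S"
      unfolding R_def using \<open>L K \<ge> 1\<close> by (intro CollectI exI[of _ "{s}"]) auto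
    then show ?thesis by blast
  qed
  have eq: "extraction_ratio L K = Inf {Max (R S) | n S. n \<ge> 1 \<and> S \<noteq> {} \<and> S \<subseteq> F2 n \<and>
      real (additive_energy S) \<ge> inverse K * real (card S) ^ 3}" (is "_ = Inf ?A")
    by (simp only: extraction_ratio_def R_def)
  obtain n S where S: "n \<ge> 1" "S \<noteq> {}" "S \<subseteq> F2 n"
    "additive_energy S \<ge> inverse K * real (card S) ^ 3"
    "\<And>Y. Y \<subseteq> S \<Longrightarrow> card (Y + Y) \<le> L K * card Y \<Longrightarrow> card Y / card S \<le> 1 / r + e"
    by (rule exists_energetic_set_with_small_extractions
        [OF \<open>L K \<ge> 0\<close> \<open>e > 0\<close> \<open>r \<ge> 1\<close>, folded K_def]) (rule that)
  \<comment> \<open>Passing from \<open>Inf\<close> to a member requires a lower bound; each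
    \<open>Max\<close> is attained, hence is a nonnegative ratio.\<close>
  have "bdd_below ?A"
  proof (rule bdd_belowI[of _ 0])
    fix x assume "x \<in> ?A"
    then obtain n' S' where x: "x = Max (R S')" "S' \<noteq> {}" "S' \<subseteq> F2 n'" by blast
    then have "x \<in> R S'" using Max_in[OF finite nonempty] by blast
    then show "0 \<le> x" by (auto simp: R_def)
  qed
  moreover have "Max (R S) \<in> ?A"
    using S(1-4) by (intro CollectI exI[of _ n] exI[of _ S] conjI refl)
  ultimately have "extraction_ratio L K \<le> Max (R S)"
    unfolding eq by (intro cInf_lower)
  also have "\<dots> \<le> 1 / r + e"
  proof (rule Max.boundedI)
    fix x assume "x \<in> R S" then show "x \<le> 1 / r + e" using S(5) by (auto simp: R_def)
  qed (use finite[OF S(3)] nonempty[OF S(2)] in auto)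
  finally show "extraction_ratio L ((real r)^2) \<le> 1 / r + e" by (simp add: K_def)
qed

text \<open>Argued on the extremal set directly, without the infimum: the set \<open>Y\<close>
  guaranteed there has ratio at least \<open>\<gamma> K\<close> and at most
  \<open>1 / r + e\<close>.\<close>

lemma extraction_guarantee_le:
  fixes r :: nat
  assumes L: "L ((real r)^2) \<ge> 1" and "r \<ge> 1" and guarantee: "extraction_guarantee L \<gamma>"
  shows "\<gamma> ((real r)^2) \<le> 1 / r"
proof (rule field_le_epsilon)
  fix e :: real assume "e > 0"
  define K where "K = (real r)^2"
  have "K \<ge> 1" using \<open>r \<ge> 1\<close> by (simp add: K_def)
  have "L K \<ge> 0" using L by (simp add: K_def)
  obtain n S where S: "n \<ge> 1" "S \<noteq> {}" "S \<subseteq> F2 n"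
    "additive_energy S \<ge> inverse K * real (card S) ^ 3"
    "\<And>Y. Y \<subseteq> S \<Longrightarrow> card (Y + Y) \<le> L K * card Y \<Longrightarrow> card Y / card S \<le> 1 / r + e"
    by (rule exists_energetic_set_with_small_extractions
        [OF \<open>L K \<ge> 0\<close> \<open>e > 0\<close> \<open>r \<ge> 1\<close>, folded K_def]) (rule that)
  have "finite S" using S(3) finite_F2 by (rule finite_subset)
  then have "card S > 0" using S(2) by (simp add: card_gt_0_iff)
  have "\<exists>Y. Y \<noteq> {} \<and> Y \<subseteq> S \<and> real (card (Y + Y)) \<le> L K * real (card Y) \<and>
      real (card Y) \<ge> \<gamma> K * real (card S)"
    using guarantee[unfolded extraction_guarantee_def, rule_format, OF \<open>K \<ge> 1\<close> S(1)] S(2-4)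
    unfolding inverse_eq_divide by simp
  then obtain Y where Y: "Y \<subseteq> S" "card (Y + Y) \<le> L K * card Y"
    and "card Y \<ge> \<gamma> K * card S"
    by (elim exE conjE) (rule that)
  then have "\<gamma> K \<le> card Y / card S"
    using \<open>card S > 0\<close> by (simp add: le_divide_eq)
  also have "\<dots> \<le> 1 / r + e"
    using Y by (rule S(5))
  finally show "\<gamma> ((real r)^2) \<le> 1 / r + e" by (simp add: K_def)
qed

section \<open>The contamination threshold\<close>

lemma positive_overlap_bound_less:
  fixes g \<eta> :: real
  assumes "0 \<le> g" "g < 1" "positive_overlap_bound g \<eta>"
  shows "\<eta> < g / (1 - g)"
proof (rule ccontr)
  \<comment> \<open>If \<open>|V| = h |A|\<close>, then \<open>V\<close> makes up exactly the
    fraction \<open>g\<close> of the disjoint union of \<open>A\<close> and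
    \<open>V\<close>.\<close>
  define h where "h = g / (1 - g)"
  assume "\<not> \<eta> < g / (1 - g)"
  then have "h \<le> \<eta>" by (simp add: h_def)
  have "h \<ge> 0" and h: "(1 - g) * h = g" using assms by (simp_all add: h_def)
  obtain c where "c > 0" and c: "\<forall>n\<ge>1. \<forall>A B Y.
      A \<subseteq> F2 n \<and> B \<subseteq> F2 n \<and> Y \<subseteq> F2 n \<and> A \<noteq> {} \<and>
      Y \<subseteq> B \<and> real (card Y) \<ge> g * real (card B) \<and>
      real (card (sym_diff A B)) \<le> \<eta> * real (card A) \<longrightarrow>
      real (card (A \<inter> Y)) \<ge> c * real (card A)"
    using assms(3) unfolding positive_overlap_bound_def by (elim exE conjE) (rule that)
  \<comment> \<open>With \<open>|A| = a\<close>, a single point is less than the fraction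
    \<open>c\<close> of \<open>A\<close>.\<close>
  obtain a :: nat where "1 / c < a" using reals_Archimedean2 by blast
  moreover have "1 / c > 0" using \<open>c > 0\<close> by simp
  ultimately have "a > 0" by linarith
  have ca: "1 < c * a" using \<open>1 / c < a\<close> \<open>c > 0\<close> by (simp add: field_simps)
  \<comment> \<open>Rounding down respects the contamination bound; \<open>h * a < v + 1\<close> is
    what the extra point in \<open>?Y\<close> pays for.\<close>
  define v where "v = nat \<lfloor>h * a\<rfloor>"
  have "real v = of_int \<lfloor>h * a\<rfloor>"
    using \<open>h \<ge> 0\<close> by (simp add: v_def)
  then have v: "real v \<le> h * a" "h * a < v + 1"
    by linarith+
  \<comment> \<open>Any dimension with \<open>2 ^ n \<ge> a + v\<close> leaves enough room.
    \<open>B\<close> is chosen first and \<open>A\<close> inside it, so \<open>V\<close> is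
    \<open>B - A\<close>.\<close>
  define n where "n = a + v"
  have "a + v \<le> card (F2 n)"
    unfolding card_F2 n_def by (rule less_imp_le[OF less_exp])
  then obtain B where B: "B \<subseteq> F2 n" "card B = a + v" "finite B"
    using obtain_subset_with_card_n by metis
  obtain A where A: "A \<subseteq> B" "card A = a" "finite A"
    using obtain_subset_with_card_n[of a B] B(2) by auto
  then have "A \<noteq> {}" using \<open>a > 0\<close> by auto
  then obtain w where "w \<in> A" by auto
  let ?Y = "insert w (B - A)"
  have cardV: "card (B - A) = v"
    using A B by (simp add: card_Diff_subset)
  have "c * real (card A) \<le> real (card (A \<inter> ?Y))"
  proof (intro c[rule_format] conjI)
    show "n \<ge> 1" using \<open>a > 0\<close> by (simp add: n_def)
    have "card ?Y = v + 1"
      using B(3) \<open>w \<in> A\<close> cardV by simp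
    \<comment> \<open>The left side is \<open>g * a\<close>. Rearranging gives
      \<open>g * (a + v) \<le> v + 1 - g\<close>, which is at most \<open>v + 1\<close>.\<close>
    moreover have "(1 - g) * (h * a) \<le> (1 - g) * (v + 1)"
      using v(2) \<open>g < 1\<close> by (intro mult_left_mono) auto
    then have "g * a \<le> (1 - g) * (v + 1)"
      by (simp only: mult.assoc[symmetric] h)
    then have "g * (a + v) \<le> v + 1"
      using \<open>0 \<le> g\<close> by (simp add: algebra_simps)
    ultimately show "g * real (card B) \<le> real (card ?Y)"
      by (simp add: B(2))
    have "sym_diff A B = B - A" using A(1) by blast
    moreover have "h * a \<le> \<eta> * a"
      using \<open>h \<le> \<eta>\<close> by (intro mult_right_mono) auto
    ultimately show "real (card (sym_diff A B)) \<le> \<eta> * real (card A)"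
      using v(1) A(2) cardV by simp
  qed (use A B \<open>w \<in> A\<close> in auto)
  moreover have "A \<inter> ?Y = {w}" using \<open>w \<in> A\<close> by auto
  ultimately show False using ca A(2) by simp
qed

theorem theorem8p5:
  fixes L :: "real \<Rightarrow> real"
  assumes L: "\<forall>x\<ge>1. L x \<ge> 1"
  shows
    "(\<forall>r::nat. r \<ge> 2 \<longrightarrow> (let K = (real r)^2 in
        extraction_ratio L K \<le> 1 / real r \<and> 1 / real r = K powr (-1/2))) \<and>
     (\<forall>\<gamma> :: real \<Rightarrow> real.
        (\<forall>K\<ge>1. 0 \<le> \<gamma> K \<and> \<gamma> K \<le> 1) \<and> extraction_guarantee L \<gamma> \<longrightarrow>
        (\<forall>r::nat. r \<ge> 2 \<longrightarrow> (let K = (real r)^2 in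
           \<gamma> K \<le> K powr (-1/2) \<and>
           (\<forall>\<eta>\<ge>0. positive_overlap_bound (\<gamma> K) \<eta> \<longrightarrow> \<eta> < \<gamma> K / (1 - \<gamma> K)) \<and>
           \<gamma> K / (1 - \<gamma> K) \<le> 1 / (real r - 1) \<and>
           1 / (real r - 1) = 1 / (sqrt K - 1))) \<and>
        (\<exists>\<epsilon> :: nat \<Rightarrow> real. \<epsilon> \<longlonglongrightarrow> 0 \<and>
           (\<forall>r::nat. r \<ge> 2 \<longrightarrow> (let K = (real r)^2 in
              \<forall>\<eta>\<ge>0. positive_overlap_bound (\<gamma> K) \<eta> \<longrightarrow> \<eta> \<le> (1 + \<epsilon> r) * K powr (-1/2)))))"
proof -
  have K1: "(real r)^2 \<ge> 1" if "r \<ge> 2" for r :: nat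
    using that by simp
  have powr: "((real r)^2) powr (-1/2) = 1 / r" if "r \<ge> 2" for r :: nat
    using that by (simp add: powr_half_sqrt powr_minus_divide)
  have part1: "extraction_ratio L ((real r)^2) \<le> 1 / r" if "r \<ge> 2" for r :: nat
    using that L K1 by (intro extraction_ratio_le) auto
  have part2: "\<gamma> ((real r)^2) \<le> 1 / r"
    "\<gamma> ((real r)^2) / (1 - \<gamma> ((real r)^2)) \<le> 1 / (real r - 1)"
    "\<And>\<eta>. positive_overlap_bound (\<gamma> ((real r)^2)) \<eta> \<Longrightarrow>
        \<eta> < \<gamma> ((real r)^2) / (1 - \<gamma> ((real r)^2))"
    "\<And>\<eta>. positive_overlap_bound (\<gamma> ((real r)^2)) \<eta> \<Longrightarrow> \<eta> \<le> (1 + 1 / (real r - 1)) * (1 / r)"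
    if \<gamma>: "\<forall>K\<ge>1. 0 \<le> \<gamma> K \<and> \<gamma> K \<le> 1" "extraction_guarantee L \<gamma>" and r: "r \<ge> 2"
    for \<gamma> and r :: nat
  proof -
    define g where "g = \<gamma> ((real r)^2)"
    have "g \<ge> 0" using \<gamma>(1) K1[OF r] by (simp add: g_def)
    have g: "g \<le> 1 / r"
      unfolding g_def using r L K1 \<gamma>(2) by (intro extraction_guarantee_le) auto
    \<comment> \<open>From \<open>r \<ge> 2\<close> comes \<open>g < 1\<close>, which the threshold
      lemma requires.\<close>
    have "1 / real r < 1" using r by simp
    then have "g < 1" using g by linarith
    have quot: "g / (1 - g) \<le> 1 / (real r - 1)"
      using g \<open>g < 1\<close> r by (simp add: field_simps)
    have less: "\<eta> < g / (1 - g)" if "positive_overlap_bound g \<eta>" for \<eta>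
      using \<open>g \<ge> 0\<close> \<open>g < 1\<close> that by (rule positive_overlap_bound_less)
    \<comment> \<open>This identity exhibits the o(1) term explicitly as
      \<open>1 / (real r - 1)\<close>.\<close>
    have "1 / (real r - 1) = (1 + 1 / (real r - 1)) * (1 / r)"
      using r by (simp add: field_simps)
    then have "\<eta> \<le> (1 + 1 / (real r - 1)) * (1 / r)" if "positive_overlap_bound g \<eta>" for \<eta>
      using less[OF that] quot by linarith
    then show "\<gamma> ((real r)^2) \<le> 1 / r"
      "\<gamma> ((real r)^2) / (1 - \<gamma> ((real r)^2)) \<le> 1 / (real r - 1)"
      "\<And>\<eta>. positive_overlap_bound (\<gamma> ((real r)^2)) \<eta> \<Longrightarrow>
          \<eta> < \<gamma> ((real r)^2) / (1 - \<gamma> ((real r)^2))"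
      "\<And>\<eta>. positive_overlap_bound (\<gamma> ((real r)^2)) \<eta> \<Longrightarrow> \<eta> \<le> (1 + 1 / (real r - 1)) * (1 / r)"
      using g quot less by (simp_all only: g_def)
  qed
  \<comment> \<open>Shifting the index by one turns this into the sequence
    \<open>1 / real r\<close>.\<close>
  have lim: "(\<lambda>r. 1 / (real r - 1)) \<longlonglongrightarrow> 0"
    by (rule LIMSEQ_offset[where k = 1]) (simp add: lim_1_over_n)
  show ?thesis
    unfolding Let_def
  proof (intro conjI allI impI; (elim conjE)?)
    fix r :: nat assume "r \<ge> 2"
    then show "extraction_ratio L ((real r)^2) \<le> 1 / r" "1 / r = ((real r)^2) powr (-1/2)"
      using part1 powr by simp_all
  next
    fix \<gamma> :: "real \<Rightarrow> real" and r :: nat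
    assume \<gamma>: "\<forall>K\<ge>1. 0 \<le> \<gamma> K \<and> \<gamma> K \<le> 1" "extraction_guarantee L \<gamma>" and r: "r \<ge> 2"
    show "\<gamma> ((real r)^2) \<le> ((real r)^2) powr (-1/2)"
      unfolding powr[OF r] using \<gamma> r by (rule part2(1))
    show "\<gamma> ((real r)^2) / (1 - \<gamma> ((real r)^2)) \<le> 1 / (real r - 1)"
      using \<gamma> r by (rule part2(2))
    show "1 / (real r - 1) = 1 / (sqrt ((real r)^2) - 1)"
      by simp
    fix \<eta> assume "positive_overlap_bound (\<gamma> ((real r)^2)) \<eta>"
    with \<gamma> r show "\<eta> < \<gamma> ((real r)^2) / (1 - \<gamma> ((real r)^2))"
      by (rule part2(3))
  next
    fix \<gamma> :: "real \<Rightarrow> real"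
    assume \<gamma>: "\<forall>K\<ge>1. 0 \<le> \<gamma> K \<and> \<gamma> K \<le> 1" "extraction_guarantee L \<gamma>"
    have "\<eta> \<le> (1 + 1 / (real r - 1)) * ((real r)^2) powr (-1/2)"
      if "r \<ge> 2" "positive_overlap_bound (\<gamma> ((real r)^2)) \<eta>" for r :: nat and \<eta>
      using part2(4)[OF \<gamma> that] by (simp only: powr[OF that(1)])
    then show "\<exists>\<epsilon> :: nat \<Rightarrow> real. \<epsilon> \<longlonglongrightarrow> 0 \<and> (\<forall>r\<ge>2. \<forall>\<eta>\<ge>0.
        positive_overlap_bound (\<gamma> ((real r)^2)) \<eta> \<longrightarrow> \<eta> \<le> (1 + \<epsilon> r) * ((real r)^2) powr (-1/2))"
      using lim by (intro exI[of _ "\<lambda>r. 1 / (real r - 1)"]) blast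
  qed
qed

end
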